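(* Let $K$ be a Grothendieck topology on the big cell $\mathtt{D}$. The following are equivalent: 1. Every $K$-covering sieve on every object $n$ of $\mathtt{D}$ contains a finitely generated $K$-covering sieve on $n$. 2. $K=K_S$ for some patch $S\subseteq\mathbb{S}$, where $K_S$ is the Grothendieck topology on $\mathtt{D}$ for which a sieve $L$ on $n$ is covering if and only if, as a subset of $\mathbb{S}$, $L$ contains $(n)\cap S$.
   Context: The big cell $\mathtt{D}$ is the poset category whose objects are the strictly positive natural numbers $\mathbb{N}_+$, with a unique morphism $m\to n$ whenever $n\mid m$. $\mathbb{S}$ is the set of supernatural numbers, i.e. formal products $\prod_p p^{e_p}$ over all primes with $e_p\in\{0,1,2,\dots\}\cup\{\infty\}$, with the obvious divisibility relation. It carries the localic topology, whose open sets are the sets $(n_i)_{i\in I}=\{s\in\mathbb{S}:\exists i\in I,\ n_i\mid s\}$ with $n_i\in\mathbb{N}_+$; in particular $(n)=\{s:n\mid s\}$. A sieve $\{n_i\to n\}_{i\in I}$ on $n$ is identified with the open set $(n_i)_{i\in I}$. A sieve is finitely generated if it is generated by a finite (possibly empty) family of morphisms. A spectral space is a topological space $X$ such that: (S1) $X$ is $T_0$ and quasi-compact; (S2) the quasi-compact open sets form a basis; (S3) the intersection of two quasi-compact open sets is quasi-compact; (S4) every non-empty irreducible closed subset has a generic point. $\mathbb{S}$ with the localic topology is a spectral space. For $X$ a spectral space, a patch $Y\subseteq X$ is a subspace that is itself a spectral space and such that $U\cap Y$ is a quasi-compact open of $Y$ for every quasi-compact open $U$ of $X$. *)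

theory Defs
  imports "HOL-Analysis.Analysis" "HOL-Computational_Algebra.Primes"
begin

section \<open>Grothendieck topologies on a poset category\<close>

text \<open>
  A poset category is given by a relation \<open>C\<close> with \<open>(m, n) \<in> C\<close> iff there is a (necessarily
  unique) morphism \<open>m \<rightarrow> n\<close>; as all identities are present, \<open>Field C\<close> is its set of objects.
  A morphism into a fixed object \<open>c\<close> is determined by its domain, so a family of morphisms with
  codomain \<open>c\<close>, in particular a sieve on \<open>c\<close>, is represented by the set of the domains.
\<close>

definition sieve_on :: "'o rel \<Rightarrow> 'o \<Rightarrow> 'o set \<Rightarrow> bool" where
  "sieve_on C c L \<longleftrightarrow> c \<in> Field C \<and> (\<forall>m\<in>L. (m, c) \<in> C) \<and> (\<forall>m\<in>L. \<forall>k. (k, m) \<in> C \<longrightarrow> k \<in> L)"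

definition maximal_sieve :: "'o rel \<Rightarrow> 'o \<Rightarrow> 'o set" where
  "maximal_sieve C c = {m. (m, c) \<in> C}"

definition pullback_sieve :: "'o rel \<Rightarrow> 'o \<Rightarrow> 'o set \<Rightarrow> 'o set" where
  "pullback_sieve C d L = {k. (k, d) \<in> C \<and> k \<in> L}"

definition generated_sieve :: "'o rel \<Rightarrow> 'o set \<Rightarrow> 'o set" where
  "generated_sieve C F = {k. \<exists>m\<in>F. (k, m) \<in> C}"

definition finitely_generated_sieve_on :: "'o rel \<Rightarrow> 'o \<Rightarrow> 'o set \<Rightarrow> bool" where
  "finitely_generated_sieve_on C c L \<longleftrightarrow>
     sieve_on C c L \<and> (\<exists>F. finite F \<and> (\<forall>m\<in>F. (m, c) \<in> C) \<and> L = generated_sieve C F)"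

text \<open>
  \<open>J c\<close> is the set of covering sieves on \<open>c\<close>. The first clause forces \<open>J c = {}\<close> when \<open>c\<close> is not an
  object, so that two topologies are equal as functions iff they have the same covering sieves.
\<close>

definition grothendieck_topology :: "'o rel \<Rightarrow> ('o \<Rightarrow> 'o set set) \<Rightarrow> bool" where
  "grothendieck_topology C J \<longleftrightarrow>
     (\<forall>c. \<forall>L\<in>J c. sieve_on C c L) \<and>
     (\<forall>c\<in>Field C. maximal_sieve C c \<in> J c) \<and>
     (\<forall>c d. \<forall>L\<in>J c. (d, c) \<in> C \<longrightarrow> pullback_sieve C d L \<in> J d) \<and>
     (\<forall>c R. \<forall>L\<in>J c. sieve_on C c R \<and> (\<forall>d\<in>L. pullback_sieve C d R \<in> J d) \<longrightarrow> R \<in> J c)"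

section \<open>The big cell\<close>

definition big_cell :: "nat rel" where
  "big_cell = {(m, n). 0 < m \<and> 0 < n \<and> n dvd m}"

lemma Field_big_cell: "Field big_cell = {0<..}"
  unfolding Field_def big_cell_def by auto

lemma big_cell_trans: "(k, m) \<in> big_cell \<Longrightarrow> (m, n) \<in> big_cell \<Longrightarrow> (k, n) \<in> big_cell"
  unfolding big_cell_def by (auto dest: dvd_trans)

lemma partial_order_on_big_cell: "partial_order_on {0<..} big_cell"
proof -
  have "antisym big_cell" by (auto simp: antisym_def big_cell_def dvd_antisym)
  moreover have "refl_on {0<..} big_cell" by (auto simp: refl_on_def big_cell_def)
  moreover have "big_cell \<subseteq> {0<..} \<times> {0<..}" by (auto simp: big_cell_def)
  ultimately show ?thesis
    using big_cell_trans by (auto simp: partial_order_on_def preorder_on_def trans_def)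
qed

section \<open>Supernatural numbers\<close>

text \<open>A formal product of prime powers is given by its exponents; non-primes get exponent 0.\<close>

typedef supernat = "{e :: nat \<Rightarrow> enat. \<forall>p. \<not> prime p \<longrightarrow> e p = 0}"
  morphisms exponent Abs_supernat
  by (rule exI[of _ "\<lambda>_. 0"]) simp

setup_lifting type_definition_supernat

definition supernat_dvd :: "supernat \<Rightarrow> supernat \<Rightarrow> bool" (infix "sdvd" 50) where
  "s sdvd t \<longleftrightarrow> (\<forall>p. prime p \<longrightarrow> exponent s p \<le> exponent t p)"

text \<open>Only meaningful for positive arguments.\<close>

lift_definition supernat_of_nat :: "nat \<Rightarrow> supernat" is
  "\<lambda>n p. if prime p then enat (multiplicity p n) else 0"
  by simp

lemma exponent_supernat_of_nat:
  "prime p \<Longrightarrow> exponent (supernat_of_nat n) p = enat (multiplicity p n)"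
  by transfer simp

lemma supernat_of_nat_sdvd_iff:
  assumes "0 < m" "0 < n"
  shows "supernat_of_nat m sdvd supernat_of_nat n \<longleftrightarrow> m dvd n"
proof
  assume "supernat_of_nat m sdvd supernat_of_nat n"
  then have "\<And>p. prime p \<Longrightarrow> multiplicity p m \<le> multiplicity p n"
    by (simp add: supernat_dvd_def exponent_supernat_of_nat)
  then show "m dvd n" using assms multiplicity_le_imp_dvd by blast
next
  assume "m dvd n"
  then show "supernat_of_nat m sdvd supernat_of_nat n"
    using assms by (simp add: supernat_dvd_def exponent_supernat_of_nat dvd_imp_multiplicity_le)
qed

lemma supernat_of_nat_lcm_sdvd_iff:
  assumes "0 < m" "0 < n"
  shows "supernat_of_nat (lcm m n) sdvd s \<longleftrightarrow> supernat_of_nat m sdvd s \<and> supernat_of_nat n sdvd s"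
proof -
  have "enat (max a b) \<le> e \<longleftrightarrow> enat a \<le> e \<and> enat b \<le> e" for a b e
    by (cases e) auto
  then show ?thesis
    using assms unfolding supernat_dvd_def
    by (auto simp: exponent_supernat_of_nat multiplicity_lcm)
qed

text \<open>The open set \<open>(n\<^sub>i)\<^sub>i\<close> given by a set of positive natural numbers, in particular by a sieve.\<close>

definition supernat_open :: "nat set \<Rightarrow> supernat set" where
  "supernat_open N = {s. \<exists>n\<in>N. supernat_of_nat n sdvd s}"

definition localic_topology :: "supernat topology" where
  "localic_topology = topology (\<lambda>U. \<exists>N\<subseteq>{0<..}. U = supernat_open N)"

lemma openin_localic_topology:
  "openin localic_topology U \<longleftrightarrow> (\<exists>N\<subseteq>{0<..}. U = supernat_open N)"
proof -
  have "istopology (\<lambda>U. \<exists>N\<subseteq>{0<..}. U = supernat_open N)"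
    unfolding istopology_def
  proof (intro conjI allI impI)
    fix U V
    assume "\<exists>N\<subseteq>{0<..}. U = supernat_open N" "\<exists>N\<subseteq>{0<..}. V = supernat_open N"
    then obtain M N where MN: "M \<subseteq> {0<..}" "U = supernat_open M" "N \<subseteq> {0<..}" "V = supernat_open N"
      by auto
    have "U \<inter> V = supernat_open {lcm m n |m n. m \<in> M \<and> n \<in> N}"
    proof (rule set_eqI)
      fix s
      have "(\<exists>m\<in>M. supernat_of_nat m sdvd s) \<and> (\<exists>n\<in>N. supernat_of_nat n sdvd s) \<longleftrightarrow>
        (\<exists>m\<in>M. \<exists>n\<in>N. supernat_of_nat (lcm m n) sdvd s)"
        using MN(1,3) supernat_of_nat_lcm_sdvd_iff by (meson greaterThan_iff subsetD)
      then show "s \<in> U \<inter> V \<longleftrightarrow> s \<in> supernat_open {lcm m n |m n. m \<in> M \<and> n \<in> N}"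
        unfolding MN(2,4) supernat_open_def by auto
    qed
    moreover have "{lcm m n |m n. m \<in> M \<and> n \<in> N} \<subseteq> {0<..}"
      using MN(1,3) by (auto simp: lcm_pos_nat subset_iff)
    ultimately show "\<exists>N\<subseteq>{0<..}. U \<inter> V = supernat_open N" by blast
  next
    fix \<U> :: "supernat set set"
    assume "\<forall>U\<in>\<U>. \<exists>N\<subseteq>{0<..}. U = supernat_open N"
    then obtain f where f: "\<And>U. U \<in> \<U> \<Longrightarrow> f U \<subseteq> {0<..} \<and> U = supernat_open (f U)" by metis
    have "supernat_open (\<Union>(f ` \<U>)) = (\<Union>U\<in>\<U>. supernat_open (f U))"
      by (auto simp: supernat_open_def)
    also have "\<dots> = \<Union>\<U>" using f by auto
    finally have "\<Union>\<U> = supernat_open (\<Union>(f ` \<U>))" ..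
    moreover have "\<Union>(f ` \<U>) \<subseteq> {0<..}" using f by (simp add: UN_subset_iff)
    ultimately show "\<exists>N\<subseteq>{0<..}. \<Union>\<U> = supernat_open N"
      by (intro exI[of _ "\<Union>(f ` \<U>)"] conjI)
  qed
  then show ?thesis by (simp add: localic_topology_def)
qed

lemma topspace_localic_topology: "topspace localic_topology = UNIV"
proof -
  have "s \<in> supernat_open {1}" for s
    by (simp add: supernat_open_def supernat_dvd_def exponent_supernat_of_nat zero_enat_def[symmetric])
  then have "openin localic_topology UNIV"
    unfolding openin_localic_topology by (intro exI[of _ "{1}"]) auto
  then show ?thesis using openin_subset by blast
qed

section \<open>Spectral spaces and patches\<close>

definition quasi_compact_openin :: "'a topology \<Rightarrow> 'a set \<Rightarrow> bool" where
  "quasi_compact_openin X U \<longleftrightarrow> openin X U \<and> compactin X U"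

definition irreducible_closedin :: "'a topology \<Rightarrow> 'a set \<Rightarrow> bool" where
  "irreducible_closedin X Z \<longleftrightarrow> closedin X Z \<and> Z \<noteq> {} \<and>
     (\<forall>A B. closedin X A \<and> closedin X B \<and> Z = A \<union> B \<longrightarrow> Z = A \<or> Z = B)"

text \<open>Neither \<^const>\<open>compact_space\<close> nor \<^const>\<open>compactin\<close> presupposes a separation axiom.\<close>

definition spectral_space :: "'a topology \<Rightarrow> bool" where
  "spectral_space X \<longleftrightarrow>
     t0_space X \<and> compact_space X \<and>
     openin X = arbitrary union_of quasi_compact_openin X \<and>
     (\<forall>U V. quasi_compact_openin X U \<and> quasi_compact_openin X V \<longrightarrow> compactin X (U \<inter> V)) \<and>
     (\<forall>Z. irreducible_closedin X Z \<longrightarrow> (\<exists>x\<in>topspace X. X closure_of {x} = Z))"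

definition patch :: "'a topology \<Rightarrow> 'a set \<Rightarrow> bool" where
  "patch X Y \<longleftrightarrow> Y \<subseteq> topspace X \<and> spectral_space (subtopology X Y) \<and>
     (\<forall>U. quasi_compact_openin X U \<longrightarrow> quasi_compact_openin (subtopology X Y) (U \<inter> Y))"

section \<open>The Grothendieck topology given by a set of supernatural numbers\<close>

definition topology_of_points :: "supernat set \<Rightarrow> nat \<Rightarrow> nat set set" where
  "topology_of_points S n = {L. sieve_on big_cell n L \<and> supernat_open {n} \<inter> S \<subseteq> supernat_open L}"

lemma supernat_dvd_trans: "s sdvd t \<Longrightarrow> t sdvd u \<Longrightarrow> s sdvd u"
  unfolding supernat_dvd_def by (meson order_trans)

lemma grothendieck_topology_of_points: "grothendieck_topology big_cell (topology_of_points S)"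
  unfolding grothendieck_topology_def
proof (intro conjI allI ballI impI)
  fix c L assume "L \<in> topology_of_points S c"
  then show "sieve_on big_cell c L" by (simp add: topology_of_points_def)
next
  fix c assume c: "c \<in> Field big_cell"
  then have "c \<in> maximal_sieve big_cell c"
    unfolding Field_big_cell by (simp add: maximal_sieve_def big_cell_def)
  moreover have "sieve_on big_cell c (maximal_sieve big_cell c)"
    using c big_cell_trans unfolding sieve_on_def maximal_sieve_def by blast
  ultimately show "maximal_sieve big_cell c \<in> topology_of_points S c"
    unfolding topology_of_points_def supernat_open_def by blast
next
  fix c d L assume L: "L \<in> topology_of_points S c" and dc: "(d, c) \<in> big_cell"
  have pos: "0 < c" "0 < d" "c dvd d" using dc by (auto simp: big_cell_def)
  have sL: "sieve_on big_cell c L" and cov: "supernat_open {c} \<inter> S \<subseteq> supernat_open L"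
    using L by (auto simp: topology_of_points_def)
  have "s \<in> supernat_open (pullback_sieve big_cell d L)" if s: "s \<in> S" "supernat_of_nat d sdvd s" for s
  proof -
    have "supernat_of_nat c sdvd s"
      using pos s(2) supernat_dvd_trans supernat_of_nat_sdvd_iff by blast
    then obtain m where m: "m \<in> L" "supernat_of_nat m sdvd s"
      using cov s(1) by (auto simp: supernat_open_def)
    have m0: "0 < m" using sL m(1) by (auto simp: sieve_on_def big_cell_def)
    have "supernat_of_nat (lcm m d) sdvd s"
      using m(2) s(2) m0 pos(2) supernat_of_nat_lcm_sdvd_iff by blast
    moreover have "(lcm m d, m) \<in> big_cell" "(lcm m d, d) \<in> big_cell"
      using m0 pos(2) by (auto simp: big_cell_def lcm_pos_nat)
    ultimately show ?thesis
      using sL m(1) unfolding supernat_open_def pullback_sieve_def sieve_on_def by blast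
  qed
  moreover have "sieve_on big_cell d (pullback_sieve big_cell d L)"
    using sL pos(2) big_cell_trans
    unfolding sieve_on_def pullback_sieve_def Field_big_cell by blast
  ultimately show "pullback_sieve big_cell d L \<in> topology_of_points S d"
    by (auto simp: topology_of_points_def supernat_open_def)
next
  fix c R L
  assume L: "L \<in> topology_of_points S c"
    and R: "sieve_on big_cell c R \<and> (\<forall>d\<in>L. pullback_sieve big_cell d R \<in> topology_of_points S d)"
  have "s \<in> supernat_open R" if s: "s \<in> supernat_open {c} \<inter> S" for s
  proof -
    obtain d where d: "d \<in> L" "supernat_of_nat d sdvd s"
      using L s by (auto simp: topology_of_points_def supernat_open_def)
    then have "s \<in> supernat_open (pullback_sieve big_cell d R)"
      using R s by (auto simp: topology_of_points_def supernat_open_def)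
    then show ?thesis by (auto simp: supernat_open_def pullback_sieve_def)
  qed
  then show "R \<in> topology_of_points S c"
    using R by (auto simp: topology_of_points_def)
qed

end

theory Submission
  imports Defs
begin

text \<open>
  Let \<^term>\<open>K\<close> be a Grothendieck topology on the big cell. Its points are the supernatural numbers
  \<open>s\<close> such that every covering sieve on a divisor of \<open>s\<close> contains a divisor of \<open>s\<close>; they form
  the set \<open>points_of_topology K\<close>. By construction, all \<^term>\<open>K\<close>-covering sieves are covering for
  the topology given by this set \<open>S\<close>. Once every covering sieve can be shrunk to a finitely
  generated one, the converse holds as well: there are enough points
  (\<open>point_missing_noncovering_sieve\<close>). This is a prime ideal argument, run inside the lattice of
  positive natural numbers under divisibility. A supernatural number is the same thing as an
  ideal of that lattice, namely its set of finite divisors (\<open>supernat_of_divisor_ideal\<close>). Given a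
  sieve \<open>L\<close> on \<open>n\<close> that is not covering, let \<open>C\<close> consist of the multiples of \<open>n\<close> on which \<open>L\<close>
  becomes covering, and take an ideal that contains \<open>n\<close> and is maximal among those avoiding \<open>C\<close>.
  If a covering sieve on some member \<open>d\<close> of the ideal avoided the ideal, then each of its finitely
  many generators could be joined with a member of the ideal to land in \<open>C\<close>; the least common
  multiple of these members, \<open>d\<close> and \<open>n\<close> would be in the ideal, and by transitivity of
  coverings also in \<open>C\<close>.

  What remains is topology. Finitely generated sieves are finite covers by the basic open sets
  \<open>(m)\<close>, so for any set \<open>S\<close> of supernatural numbers the finiteness condition on the topology given
  by \<open>S\<close> says exactly that all sets \<open>(n) \<inter> S\<close> are quasi-compact
  (\<open>finite_type_iff_compactin_basic\<close>). Patches have this property, as \<open>(n)\<close> is quasi-compact.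
  Conversely, a set \<open>S\<close> with this property satisfies all patch axioms except perhaps the
  existence of generic points. An irreducible closed subset \<open>Z\<close> can only have as generic point the
  supernatural number whose finite divisors are those \<open>n\<close> for which \<open>(n)\<close> meets \<open>Z\<close>, and
  membership of this number in \<open>S\<close> is clear when \<open>S\<close> is the set of points of a topology
  (\<open>closed_under_divisor_unions_points_of_topology\<close>).
\<close>

section \<open>Supernatural numbers as ideals of the divisibility lattice\<close>

abbreviation nat_dvd_supernat :: "nat \<Rightarrow> supernat \<Rightarrow> bool" (infix "ndvd" 50) where
  "n ndvd s \<equiv> supernat_of_nat n sdvd s"

lemma mem_supernat_open: "s \<in> supernat_open N \<longleftrightarrow> (\<exists>n\<in>N. n ndvd s)"
  by (simp add: supernat_open_def)

lemma one_ndvd: "1 ndvd s"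
  by (simp add: supernat_dvd_def exponent_supernat_of_nat zero_enat_def[symmetric])

lemma dvd_ndvd_trans: "\<lbrakk>d dvd m; 0 < m; m ndvd s\<rbrakk> \<Longrightarrow> d ndvd s"
  using supernat_dvd_trans supernat_of_nat_sdvd_iff by (metis dvd_pos_nat)

text \<open>
  Prime powers suffice to recognize exponents, an infinite exponent being the supremum of the
  finite ones. So a supernatural number is determined by its finite divisors.
\<close>

lemma sdvd_iff_ndvd: "s sdvd t \<longleftrightarrow> (\<forall>n>0. n ndvd s \<longrightarrow> n ndvd t)"
proof
  assume R: "\<forall>n>0. n ndvd s \<longrightarrow> n ndvd t"
  show "s sdvd t"
    unfolding supernat_dvd_def
  proof (intro allI impI, rule ccontr)
    fix p :: nat assume p: "prime p" and "\<not> exponent s p \<le> exponent t p"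
    then have lt: "exponent t p < exponent s p" by simp
    then obtain k where k: "exponent t p = enat k" by (cases "exponent t p") auto
    have mult: "multiplicity q (p ^ Suc k) = (if q = p then Suc k else 0)" if "prime q" for q
      using that p
      by (auto simp: multiplicity_distinct_prime_power simp del: power_Suc
          intro!: multiplicity_same_power dest: not_prime_unit)
    have "p ^ Suc k ndvd s"
      using lt k by (auto simp: supernat_dvd_def exponent_supernat_of_nat mult zero_enat_def[symmetric]
          Suc_ile_eq simp del: power_Suc)
    then have "p ^ Suc k ndvd t" using R p prime_gt_0_nat by (metis zero_less_power)
    then have "enat (Suc k) \<le> exponent t p"
      using p mult unfolding supernat_dvd_def by (metis exponent_supernat_of_nat)
    then show False using k by simp
  qed
qed (use supernat_dvd_trans in blast)

lemma sdvd_antisym: "s sdvd t \<Longrightarrow> t sdvd s \<Longrightarrow> s = t"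
proof (rule exponent_inject[THEN iffD1], rule ext)
  fix p assume "s sdvd t" "t sdvd s"
  then show "exponent s p = exponent t p"
    using exponent[of s] exponent[of t] by (cases "prime p") (auto simp: supernat_dvd_def intro: antisym)
qed

definition divisor_ideal :: "nat set \<Rightarrow> bool" where
  "divisor_ideal I \<longleftrightarrow> I \<subseteq> {0<..} \<and> 1 \<in> I \<and> (\<forall>m\<in>I. \<forall>d. d dvd m \<longrightarrow> d \<in> I) \<and>
     (\<forall>m\<in>I. \<forall>n\<in>I. lcm m n \<in> I)"

lemma divisor_idealD:
  assumes "divisor_ideal I"
  shows "m \<in> I \<Longrightarrow> 0 < m" "1 \<in> I" "m \<in> I \<Longrightarrow> d dvd m \<Longrightarrow> d \<in> I"
    "m \<in> I \<Longrightarrow> n \<in> I \<Longrightarrow> lcm m n \<in> I"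
  using assms by (auto simp: divisor_ideal_def)

lemma divisor_ideal_Lcm:
  assumes "divisor_ideal I" "finite F" "F \<subseteq> I"
  shows "Lcm F \<in> I"
  using assms(2,3)
proof (induction F rule: finite_induct)
  case empty
  then show ?case using divisor_idealD(2)[OF assms(1)] by simp
next
  case (insert m F)
  then show ?case using divisor_idealD(4)[OF assms(1)] by simp
qed

lemma divisor_ideal_divisors: "0 < n \<Longrightarrow> divisor_ideal {d. d dvd n}"
  unfolding divisor_ideal_def by (auto intro: dvd_pos_nat dvd_trans)

lemma divisor_ideal_Union_chain:
  assumes "\<C> \<noteq> {}" "subset.chain A \<C>" "\<And>I. I \<in> \<C> \<Longrightarrow> divisor_ideal I"
  shows "divisor_ideal (\<Union>\<C>)"
proof -
  have "lcm m n \<in> \<Union>\<C>" if mn: "m \<in> I" "I \<in> \<C>" "n \<in> J" "J \<in> \<C>" for m n I J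
  proof -
    have "I \<subseteq> J \<or> J \<subseteq> I" using assms(2) mn by (auto simp: subset_chain_def)
    then show ?thesis using mn assms(3) divisor_idealD(4) by blast
  qed
  moreover have "\<Union>\<C> \<subseteq> {0<..}" using divisor_idealD(1)[OF assms(3)] by auto
  moreover have "1 \<in> \<Union>\<C>" using assms(1,3) divisor_idealD(2) by blast
  moreover have "\<forall>m\<in>\<Union>\<C>. \<forall>d. d dvd m \<longrightarrow> d \<in> \<Union>\<C>" using assms(3) divisor_idealD(3) by blast
  ultimately show ?thesis unfolding divisor_ideal_def by blast
qed

text \<open>The ideal generated by \<open>I\<close> and \<open>m\<close>.\<close>

definition extend_ideal :: "nat set \<Rightarrow> nat \<Rightarrow> nat set" where
  "extend_ideal I m = {d. \<exists>a\<in>I. d dvd lcm a m}"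

lemma divisor_ideal_extend_ideal:
  assumes I: "divisor_ideal I" and m: "0 < m"
  shows "divisor_ideal (extend_ideal I m)"
  unfolding divisor_ideal_def
proof (intro conjI ballI allI impI subsetI)
  fix d assume "d \<in> extend_ideal I m"
  then obtain a where "a \<in> I" "d dvd lcm a m" by (auto simp: extend_ideal_def)
  then show "d \<in> {0<..}"
    using divisor_idealD(1)[OF I] m dvd_pos_nat lcm_pos_nat by (metis greaterThan_iff)
next
  show "1 \<in> extend_ideal I m"
    using divisor_idealD(2)[OF I] by (auto simp: extend_ideal_def)
next
  fix d e assume "d \<in> extend_ideal I m" "e dvd d"
  then show "e \<in> extend_ideal I m" by (auto simp: extend_ideal_def intro: dvd_trans)
next
  fix d e assume "d \<in> extend_ideal I m" "e \<in> extend_ideal I m"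
  then obtain a b where ab: "a \<in> I" "b \<in> I" "d dvd lcm a m" "e dvd lcm b m"
    by (auto simp: extend_ideal_def)
  have "lcm a m dvd lcm (lcm a b) m" "lcm b m dvd lcm (lcm a b) m"
    by (simp_all add: dvd_lcmI1)
  then have "lcm d e dvd lcm (lcm a b) m"
    using ab(3,4) by (meson dvd_trans lcm_least)
  then show "lcm d e \<in> extend_ideal I m"
    using ab(1,2) divisor_idealD(4)[OF I] by (auto simp: extend_ideal_def)
qed

text \<open>
  The exponent of \<open>p\<close> has to be the supremum of the multiplicities of \<open>p\<close> in members of the ideal.
  If \<open>n\<close> divides the resulting number, then each prime power in \<open>n\<close> divides a single member of
  the ideal, because a finite number below a supremum of extended natural numbers is reached; and
  \<open>n\<close> has only finitely many prime factors, so the ideal contains their join.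
\<close>

lemma supernat_of_divisor_ideal:
  assumes I: "divisor_ideal I"
  shows "\<exists>s. \<forall>n>0. n ndvd s \<longleftrightarrow> n \<in> I"
proof -
  define s where "s = Abs_supernat (\<lambda>p. if prime p then SUP m\<in>I. enat (multiplicity p m) else 0)"
  have exps: "exponent s p = (SUP m\<in>I. enat (multiplicity p m))" if "prime p" for p
    using that unfolding s_def by (subst Abs_supernat_inverse) auto
  have "n ndvd s \<longleftrightarrow> n \<in> I" if n: "0 < n" for n
  proof
    assume "n \<in> I"
    then show "n ndvd s"
      by (auto simp: supernat_dvd_def exponent_supernat_of_nat exps intro: SUP_upper)
  next
    assume ns: "n ndvd s"
    have pow: "p ^ multiplicity p n \<in> I" if p: "prime p" for p
    proof (cases "multiplicity p n")
      case 0
      then show ?thesis using divisor_idealD(2)[OF I] by simp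
    next
      case (Suc k)
      have "enat (Suc k) \<le> (SUP m\<in>I. enat (multiplicity p m))"
        using ns p Suc unfolding supernat_dvd_def by (metis exponent_supernat_of_nat exps)
      then have "enat k < (SUP m\<in>I. enat (multiplicity p m))"
        by (simp add: Suc_ile_eq)
      then obtain m where "m \<in> I" "Suc k \<le> multiplicity p m"
        by (auto simp: less_SUP_iff)
      then show ?thesis
        using Suc divisor_idealD(3)[OF I] multiplicity_dvd' by metis
    qed
    define m where "m = Lcm ((\<lambda>p. p ^ multiplicity p n) ` prime_factors n)"
    have m: "m \<in> I"
      unfolding m_def using pow by (intro divisor_ideal_Lcm[OF I]) auto
    then have "m \<noteq> 0" using divisor_idealD(1)[OF I] by fastforce
    have "multiplicity p n \<le> multiplicity p m" if p: "prime p" for p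
    proof (cases "p \<in> prime_factors n")
      case True
      then have "p ^ multiplicity p n dvd m" unfolding m_def by (intro dvd_Lcm) auto
      then show ?thesis using p \<open>m \<noteq> 0\<close> by (intro multiplicity_geI) auto
    next
      case False
      then show ?thesis using p n by (simp add: prime_factors_multiplicity)
    qed
    then have "n dvd m" using n \<open>m \<noteq> 0\<close> by (intro multiplicity_le_imp_dvd) auto
    then show "n \<in> I" using m divisor_idealD(3)[OF I] by blast
  qed
  then show ?thesis by blast
qed

section \<open>Compactness in the localic topology\<close>

lemma openin_supernat_open: "N \<subseteq> {0<..} \<Longrightarrow> openin localic_topology (supernat_open N)"
  unfolding openin_localic_topology by blast

lemma supernat_open_mono: "M \<subseteq> N \<Longrightarrow> supernat_open M \<subseteq> supernat_open N"
  unfolding supernat_open_def by blast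

text \<open>Every open set is a union of sets \<open>(n)\<close>, so covers by those are enough to test compactness.\<close>

lemma compactin_localic_iff:
  "compactin localic_topology A \<longleftrightarrow>
     (\<forall>N\<subseteq>{0<..}. A \<subseteq> supernat_open N \<longrightarrow> (\<exists>F\<subseteq>N. finite F \<and> A \<subseteq> supernat_open F))"
proof (intro iffI allI impI)
  fix N assume A: "compactin localic_topology A" and N: "N \<subseteq> {0<..}" "A \<subseteq> supernat_open N"
  have "\<forall>U\<in>(\<lambda>n. supernat_open {n}) ` N. openin localic_topology U"
    using N(1) openin_supernat_open by blast
  moreover have "A \<subseteq> \<Union>((\<lambda>n. supernat_open {n}) ` N)"
    using N(2) by (auto simp: mem_supernat_open)
  ultimately obtain \<F> where \<F>: "finite \<F>" "\<F> \<subseteq> (\<lambda>n. supernat_open {n}) ` N" "A \<subseteq> \<Union>\<F>"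
    using A unfolding compactin_def by meson
  then obtain F where "F \<subseteq> N" "finite F" "\<F> = (\<lambda>n. supernat_open {n}) ` F"
    by (meson finite_subset_image)
  with \<F>(3) show "\<exists>F\<subseteq>N. finite F \<and> A \<subseteq> supernat_open F"
    by (intro exI[of _ F]) (auto simp: mem_supernat_open subset_iff)
next
  assume R: "\<forall>N\<subseteq>{0<..}. A \<subseteq> supernat_open N \<longrightarrow> (\<exists>F\<subseteq>N. finite F \<and> A \<subseteq> supernat_open F)"
  show "compactin localic_topology A"
    unfolding compactin_def topspace_localic_topology
  proof (intro conjI allI impI)
    fix \<U> assume \<U>: "Ball \<U> (openin localic_topology) \<and> A \<subseteq> \<Union>\<U>"
    define N where "N = {n. 0 < n \<and> (\<exists>U\<in>\<U>. supernat_open {n} \<subseteq> U)}"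
    have "A \<subseteq> supernat_open N"
    proof
      fix s assume "s \<in> A"
      then obtain U where U: "U \<in> \<U>" "s \<in> U" using \<U> by blast
      then obtain M where "M \<subseteq> {0<..}" "U = supernat_open M"
        using \<U> by (meson openin_localic_topology)
      moreover then obtain n where "n \<in> M" "n ndvd s" using U(2) by (auto simp: mem_supernat_open)
      ultimately have "n \<in> N"
        using U(1) supernat_open_mono[of "{n}" M] by (auto simp: N_def)
      then show "s \<in> supernat_open N" using \<open>n ndvd s\<close> by (auto simp: mem_supernat_open)
    qed
    moreover have "N \<subseteq> {0<..}" by (auto simp: N_def)
    ultimately obtain F where F: "F \<subseteq> N" "finite F" "A \<subseteq> supernat_open F" using R by meson
    have "\<forall>n\<in>F. \<exists>U\<in>\<U>. supernat_open {n} \<subseteq> U" using F(1) by (auto simp: N_def)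
    then obtain f where f: "\<And>n. n \<in> F \<Longrightarrow> f n \<in> \<U> \<and> supernat_open {n} \<subseteq> f n" by metis
    have "supernat_open F = (\<Union>n\<in>F. supernat_open {n})" by (auto simp: mem_supernat_open)
    then have "A \<subseteq> \<Union>(f ` F)" using F(3) f by blast
    then show "\<exists>\<F>. finite \<F> \<and> \<F> \<subseteq> \<U> \<and> A \<subseteq> \<Union>\<F>"
      using f F(2) by (intro exI[of _ "f ` F"]) auto
  qed simp
qed

text \<open>An open set that contains the number \<open>n\<close> itself already contains all of \<open>(n)\<close>.\<close>

lemma quasi_compact_openin_basic:
  assumes "0 < n"
  shows "quasi_compact_openin localic_topology (supernat_open {n})"
  unfolding quasi_compact_openin_def compactin_localic_iff
proof (intro conjI allI impI)
  show "openin localic_topology (supernat_open {n})" using assms by (simp add: openin_supernat_open)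
next
  fix N assume N: "N \<subseteq> {0<..}" "supernat_open {n} \<subseteq> supernat_open N"
  have "supernat_of_nat n \<in> supernat_open {n}"
    by (simp add: mem_supernat_open supernat_dvd_def)
  then obtain m where "m \<in> N" "m ndvd supernat_of_nat n"
    using N(2) by (auto simp: mem_supernat_open subset_iff)
  then show "\<exists>F\<subseteq>N. finite F \<and> supernat_open {n} \<subseteq> supernat_open F"
    by (intro exI[of _ "{m}"]) (auto simp: mem_supernat_open intro: supernat_dvd_trans)
qed

text \<open>
  A covering sieve on \<open>n\<close> is an open cover of \<open>(n) \<inter> S\<close> by sets \<open>(m)\<close> with \<open>n\<close> dividing \<open>m\<close>, and
  generators of a smaller covering sieve are a subcover. An arbitrary cover by sets \<open>(m)\<close> is first
  refined to such a sieve, replacing \<open>m\<close> by its common multiples with \<open>n\<close>.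
\<close>

lemma finite_type_iff_compactin_basic:
  "(\<forall>n\<in>Field big_cell. \<forall>L\<in>topology_of_points S n. \<exists>L'\<in>topology_of_points S n.
       L' \<subseteq> L \<and> finitely_generated_sieve_on big_cell n L')
     \<longleftrightarrow> (\<forall>n>0. compactin localic_topology (supernat_open {n} \<inter> S))" (is "?fin \<longleftrightarrow> ?comp")
proof
  assume fin: ?fin
  show ?comp
    unfolding compactin_localic_iff
  proof (intro allI impI)
    fix n :: nat and N
    assume n: "0 < n" and N: "N \<subseteq> {0<..}" "supernat_open {n} \<inter> S \<subseteq> supernat_open N"
    define L where "L = {k. 0 < k \<and> n dvd k \<and> (\<exists>m\<in>N. m dvd k)}"
    have "s \<in> supernat_open L" if s: "s \<in> S" "n ndvd s" for s
    proof -
      obtain m where m: "m \<in> N" "m ndvd s" using N(2) s by (auto simp: mem_supernat_open subset_iff)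
      then have "lcm n m \<in> L" using N(1) n by (auto simp: L_def lcm_pos_nat)
      moreover have "lcm n m ndvd s" using m N(1) n s(2) supernat_of_nat_lcm_sdvd_iff by auto
      ultimately show ?thesis by (auto simp: mem_supernat_open)
    qed
    moreover have "sieve_on big_cell n L"
      using n unfolding sieve_on_def Field_big_cell
      by (auto simp: big_cell_def L_def intro: dvd_trans)
    ultimately have "L \<in> topology_of_points S n"
      by (auto simp: topology_of_points_def mem_supernat_open subset_iff)
    then obtain L' where L': "L' \<in> topology_of_points S n" "L' \<subseteq> L"
        "finitely_generated_sieve_on big_cell n L'"
      using fin n unfolding Field_big_cell by (meson greaterThan_iff)
    then obtain G where G: "finite G" "\<forall>m\<in>G. (m, n) \<in> big_cell" "L' = generated_sieve big_cell G"
      by (auto simp: finitely_generated_sieve_on_def)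
    have "G \<subseteq> L"
      using G L'(2) by (fastforce simp: generated_sieve_def big_cell_def)
    then have "\<forall>g\<in>G. \<exists>m\<in>N. m dvd g" by (auto simp: L_def)
    then obtain f where f: "\<And>g. g \<in> G \<Longrightarrow> f g \<in> N \<and> f g dvd g" by metis
    have "s \<in> supernat_open (f ` G)" if s: "s \<in> supernat_open {n} \<inter> S" for s
    proof -
      obtain k where "k \<in> L'" "k ndvd s"
        using s L'(1) by (auto simp: topology_of_points_def mem_supernat_open subset_iff)
      then obtain g where "g \<in> G" "(k, g) \<in> big_cell" by (auto simp: G(3) generated_sieve_def)
      then have "f g ndvd s"
        using f[of g] \<open>k ndvd s\<close> by (auto simp: big_cell_def intro: dvd_ndvd_trans dvd_trans)
      then show ?thesis using \<open>g \<in> G\<close> by (auto simp: mem_supernat_open)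
    qed
    then show "\<exists>F\<subseteq>N. finite F \<and> supernat_open {n} \<inter> S \<subseteq> supernat_open F"
      using f G(1) by (intro exI[of _ "f ` G"]) auto
  qed
next
  assume comp: ?comp
  show ?fin
  proof (intro ballI)
    fix n L assume "n \<in> Field big_cell" and L: "L \<in> topology_of_points S n"
    then have n: "0 < n" by (simp add: Field_big_cell)
    have sieve: "sieve_on big_cell n L" and cov: "supernat_open {n} \<inter> S \<subseteq> supernat_open L"
      using L by (auto simp: topology_of_points_def)
    have L0: "L \<subseteq> {0<..}" using sieve by (auto simp: sieve_on_def big_cell_def)
    then obtain F where F: "F \<subseteq> L" "finite F" "supernat_open {n} \<inter> S \<subseteq> supernat_open F"
      using comp n cov unfolding compactin_localic_iff by meson
    let ?L' = "generated_sieve big_cell F"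
    have Fn: "\<forall>m\<in>F. (m, n) \<in> big_cell" using F(1) sieve by (auto simp: sieve_on_def)
    have "F \<subseteq> ?L'" using F(1) L0 by (auto simp: generated_sieve_def big_cell_def intro: dvd_refl)
    have s': "sieve_on big_cell n ?L'"
      unfolding sieve_on_def
    proof (intro conjI ballI allI impI)
      show "n \<in> Field big_cell" using n by (simp add: Field_big_cell)
    qed (use Fn big_cell_trans in \<open>unfold generated_sieve_def, blast+\<close>)
    have "?L' \<in> topology_of_points S n"
      using s' F(3) supernat_open_mono[OF \<open>F \<subseteq> ?L'\<close>] by (auto simp: topology_of_points_def)
    moreover have "?L' \<subseteq> L"
      using F(1) sieve by (auto simp: generated_sieve_def sieve_on_def)
    moreover have "finitely_generated_sieve_on big_cell n ?L'"
      using s' Fn F(2) by (auto simp: finitely_generated_sieve_on_def)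
    ultimately show "\<exists>L'\<in>topology_of_points S n. L' \<subseteq> L \<and> finitely_generated_sieve_on big_cell n L'"
      by blast
  qed
qed

section \<open>A recognition criterion for patches\<close>

lemma t0_space_localic_topology: "t0_space localic_topology"
  unfolding t0_space_def
proof (intro ballI impI)
  fix s t :: supernat assume "s \<noteq> t"
  then obtain n where n: "0 < n" "n ndvd s \<longleftrightarrow> \<not> n ndvd t"
    using sdvd_antisym sdvd_iff_ndvd by meson
  then show "\<exists>U. openin localic_topology U \<and> (s \<notin> U \<longleftrightarrow> t \<in> U)"
    using openin_supernat_open[of "{n}"]
    by (intro exI[of _ "supernat_open {n}"]) (auto simp: mem_supernat_open)
qed

text \<open>
  This gives soberness in the subspace: when \<open>Z\<close> is irreducible and closed in \<open>S\<close>, the \<open>s\<close> below is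
  its only possible generic point, being in a basic open set iff \<open>Z\<close> meets that set. It includes
  closure under joins of directed sets, where the finite divisors of the join are those of the
  members.
\<close>

definition closed_under_divisor_unions :: "supernat set \<Rightarrow> bool" where
  "closed_under_divisor_unions S \<longleftrightarrow> (\<forall>Z\<subseteq>S. \<forall>s. (\<forall>n>0. n ndvd s \<longleftrightarrow> (\<exists>t\<in>Z. n ndvd t)) \<longrightarrow> s \<in> S)"

text \<open>
  Irreducibility of \<open>Z\<close> says that if \<open>(m)\<close> and \<open>(n)\<close> meet \<open>Z\<close>, then so does their intersection
  \<open>(lcm m n)\<close>: otherwise \<open>Z\<close> would be the union of the two proper closed subsets obtained by
  removing \<open>(m)\<close> and \<open>(n)\<close>. So the \<open>n\<close> for which \<open>(n)\<close> meets \<open>Z\<close> form an ideal, and the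
  supernatural number of this ideal lies in exactly those basic open sets that meet \<open>Z\<close>, as a
  generic point must.
\<close>

lemma generic_point:
  assumes S: "closed_under_divisor_unions S" and irr: "irreducible_closedin (subtopology localic_topology S) Z"
  shows "\<exists>s\<in>S. subtopology localic_topology S closure_of {s} = Z"
proof -
  let ?X = "subtopology localic_topology S"
  have Zc: "closedin ?X Z" and Z0: "Z \<noteq> {}"
    and dec: "\<And>A B. closedin ?X A \<Longrightarrow> closedin ?X B \<Longrightarrow> Z = A \<union> B \<Longrightarrow> Z = A \<or> Z = B"
    using irr unfolding irreducible_closedin_def by blast+
  have ZS: "Z \<subseteq> S" using closedin_subset[OF Zc] by (simp add: topspace_localic_topology)
  define I where "I = {n. 0 < n \<and> (\<exists>t\<in>Z. n ndvd t)}"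
  have diff: "closedin ?X (Z - supernat_open {n})" if "0 < n" for n
  proof -
    have "openin ?X (supernat_open {n} \<inter> S)"
      using that by (intro openin_subtopology_Int openin_supernat_open) auto
    moreover have "Z - supernat_open {n} = Z - supernat_open {n} \<inter> S" using ZS by auto
    ultimately show ?thesis using closedin_diff[OF Zc] by metis
  qed
  have "lcm m n \<in> I" if mn: "m \<in> I" "n \<in> I" for m n
  proof (rule ccontr)
    assume "lcm m n \<notin> I"
    have pos: "0 < m" "0 < n" using mn by (auto simp: I_def)
    then have "Z = (Z - supernat_open {m}) \<union> (Z - supernat_open {n})"
      using \<open>lcm m n \<notin> I\<close>
      by (auto simp: I_def mem_supernat_open lcm_pos_nat supernat_of_nat_lcm_sdvd_iff)
    then have "Z = Z - supernat_open {m} \<or> Z = Z - supernat_open {n}"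
      using dec diff pos by blast
    then show False using mn by (auto simp: I_def mem_supernat_open)
  qed
  moreover have "1 \<in> I" using Z0 one_ndvd by (auto simp: I_def)
  ultimately have "divisor_ideal I"
    unfolding divisor_ideal_def by (auto simp: I_def intro: dvd_pos_nat dvd_ndvd_trans)
  then obtain s where s: "\<forall>n>0. n ndvd s \<longleftrightarrow> n \<in> I"
    using supernat_of_divisor_ideal by blast
  have "s \<in> S"
    using S s ZS unfolding closed_under_divisor_unions_def I_def by blast
  have "s \<in> Z"
  proof (rule ccontr)
    assume "s \<notin> Z"
    obtain V where V: "openin localic_topology V" "S - Z = V \<inter> S"
      using Zc by (auto simp: closedin_def openin_subtopology topspace_localic_topology)
    then obtain N where N: "N \<subseteq> {0<..}" "V = supernat_open N"
      by (auto simp: openin_localic_topology)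
    have "s \<in> V" using \<open>s \<in> S\<close> \<open>s \<notin> Z\<close> V(2) by auto
    then obtain n where n: "n \<in> N" "n ndvd s" using N by (auto simp: mem_supernat_open)
    moreover then have "0 < n" using N(1) by auto
    ultimately obtain u where "u \<in> Z" "n ndvd u" using s by (auto simp: I_def)
    then have "u \<in> V \<inter> S" using n N ZS by (auto simp: mem_supernat_open)
    then show False using V(2) \<open>u \<in> Z\<close> by blast
  qed
  then have "?X closure_of {s} \<subseteq> Z" using Zc by (intro closure_of_minimal) auto
  moreover have "t \<in> ?X closure_of {s}" if t: "t \<in> Z" for t
    unfolding in_closure_of
  proof (intro conjI allI impI)
    show "t \<in> topspace ?X" using t ZS by (auto simp: topspace_localic_topology)
  next
    fix T assume T: "t \<in> T \<and> openin ?X T"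
    then obtain N where N: "N \<subseteq> {0<..}" "T = supernat_open N \<inter> S"
      by (auto simp: openin_subtopology openin_localic_topology)
    then obtain n where n: "n \<in> N" "n ndvd t" using T by (auto simp: mem_supernat_open)
    then have "n ndvd s" using N t s by (auto simp: I_def)
    then have "s \<in> T" using n N \<open>s \<in> S\<close> by (auto simp: mem_supernat_open)
    then show "\<exists>y. y \<in> {s} \<and> y \<in> T" by blast
  qed
  ultimately show ?thesis using \<open>s \<in> S\<close> by blast
qed

text \<open>
  Under the compactness hypothesis the quasi-compact open subsets of \<open>S\<close> are the sets \<open>U \<inter> S\<close> where
  \<open>U\<close> is a finite union of sets \<open>(n)\<close>. These form a basis, are stable under intersection since
  \<open>(m) \<inter> (n) = (lcm m n)\<close>, and include \<open>S = (1) \<inter> S\<close>.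
\<close>

lemma patch_if_compact_and_closed_under_divisor_unions:
  assumes comp: "\<And>n. 0 < n \<Longrightarrow> compactin localic_topology (supernat_open {n} \<inter> S)"
    and S: "closed_under_divisor_unions S"
  shows "patch localic_topology S"
proof -
  let ?X = "subtopology localic_topology S"
  have comp_fin: "compactin localic_topology (supernat_open F \<inter> S)" if F: "finite F" "F \<subseteq> {0<..}" for F
  proof -
    have "supernat_open F \<inter> S = \<Union>((\<lambda>n. supernat_open {n} \<inter> S) ` F)"
      by (auto simp: mem_supernat_open)
    moreover have "compactin localic_topology (\<Union>((\<lambda>n. supernat_open {n} \<inter> S) ` F))"
      using F comp by (intro compactin_Union) auto
    ultimately show ?thesis by metis
  qed
  have qc: "quasi_compact_openin ?X (supernat_open F \<inter> S)" if "finite F" "F \<subseteq> {0<..}" for F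
    using comp_fin[OF that] openin_supernat_open[OF that(2)]
    by (auto simp: quasi_compact_openin_def compactin_subtopology openin_subtopology_Int)
  have qcD: "\<exists>F. finite F \<and> F \<subseteq> {0<..} \<and> U = supernat_open F \<inter> S"
    if U: "quasi_compact_openin ?X U" for U
  proof -
    have Uc: "compactin localic_topology U" "U \<subseteq> S"
      using U by (auto simp: quasi_compact_openin_def compactin_subtopology)
    obtain N where N: "N \<subseteq> {0<..}" "U = supernat_open N \<inter> S"
      using U by (auto simp: quasi_compact_openin_def openin_subtopology openin_localic_topology)
    then obtain F where F: "F \<subseteq> N" "finite F" "U \<subseteq> supernat_open F"
      using Uc(1) unfolding compactin_localic_iff by (metis Int_lower1)
    then show ?thesis
      using N Uc(2) supernat_open_mono[OF F(1)] by (intro exI[of _ F]) auto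
  qed
  have one: "supernat_open {1} = UNIV" using one_ndvd by (auto simp: mem_supernat_open)
  have "spectral_space ?X"
    unfolding spectral_space_def
  proof (intro conjI allI impI)
    show "t0_space ?X" by (intro t0_space_subtopology t0_space_localic_topology)
    show "compact_space ?X"
      using comp[of 1] one by (simp add: compact_space_subtopology)
    show "openin ?X = arbitrary union_of quasi_compact_openin ?X"
    proof (intro ext iffI)
      fix U assume "openin ?X U"
      then obtain N where N: "N \<subseteq> {0<..}" "U = supernat_open N \<inter> S"
        by (auto simp: openin_subtopology openin_localic_topology)
      have "U = \<Union>((\<lambda>n. supernat_open {n} \<inter> S) ` N)" using N by (auto simp: mem_supernat_open)
      moreover have "(\<lambda>n. supernat_open {n} \<inter> S) ` N \<subseteq> Collect (quasi_compact_openin ?X)"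
        using N(1) qc[of "{_}"] by auto
      ultimately show "(arbitrary union_of quasi_compact_openin ?X) U"
        unfolding union_of_def arbitrary_def by blast
    next
      fix U assume "(arbitrary union_of quasi_compact_openin ?X) U"
      then show "openin ?X U"
        by (auto simp: union_of_def arbitrary_def quasi_compact_openin_def intro!: openin_Union)
    qed
    show "compactin ?X (U \<inter> V)"
      if UV: "quasi_compact_openin ?X U \<and> quasi_compact_openin ?X V" for U V
    proof -
      obtain F G where F: "finite F" "F \<subseteq> {0<..}" "U = supernat_open F \<inter> S"
        and G: "finite G" "G \<subseteq> {0<..}" "V = supernat_open G \<inter> S"
        using UV qcD by meson
      let ?H = "(\<lambda>(m, n). lcm m n) ` (F \<times> G)"
      have H: "finite ?H" "?H \<subseteq> {0<..}" using F G by (auto simp: lcm_pos_nat subset_iff)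
      have "s \<in> supernat_open F \<and> s \<in> supernat_open G \<longleftrightarrow> s \<in> supernat_open ?H" for s
      proof -
        have "m ndvd s \<and> n ndvd s \<longleftrightarrow> lcm m n ndvd s" if "m \<in> F" "n \<in> G" for m n
          using that F(2) G(2) supernat_of_nat_lcm_sdvd_iff by (metis greaterThan_iff subsetD)
        then show ?thesis by (fastforce simp: mem_supernat_open)
      qed
      then have "U \<inter> V = supernat_open ?H \<inter> S" using F(3) G(3) by auto
      then show ?thesis using qc[OF H] by (simp add: quasi_compact_openin_def)
    qed
    show "\<exists>x\<in>topspace ?X. ?X closure_of {x} = Z" if "irreducible_closedin ?X Z" for Z
      using generic_point[OF S that] by (simp add: topspace_localic_topology)
  qed
  moreover have "quasi_compact_openin ?X (U \<inter> S)" if U: "quasi_compact_openin localic_topology U" for U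
  proof -
    have Uc: "compactin localic_topology U" using U by (simp add: quasi_compact_openin_def)
    obtain N where N: "N \<subseteq> {0<..}" "U = supernat_open N"
      using U by (auto simp: quasi_compact_openin_def openin_localic_topology)
    then obtain F where F: "F \<subseteq> N" "finite F" "U \<subseteq> supernat_open F"
      using Uc unfolding compactin_localic_iff by (metis order_refl)
    then have "U = supernat_open F" using N supernat_open_mono[OF F(1)] by auto
    then show ?thesis using qc F N by auto
  qed
  ultimately show ?thesis by (simp add: patch_def topspace_localic_topology)
qed

section \<open>The points of a Grothendieck topology\<close>

lemma sieve_on_covering_sieve: "grothendieck_topology C J \<Longrightarrow> L \<in> J c \<Longrightarrow> sieve_on C c L"
  unfolding grothendieck_topology_def by (drule conjunct1) blast

definition points_of_topology :: "(nat \<Rightarrow> nat set set) \<Rightarrow> supernat set" where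
  "points_of_topology K = {s. \<forall>n>0. n ndvd s \<longrightarrow> (\<forall>L\<in>K n. s \<in> supernat_open L)}"

text \<open>
  Being a point is a condition on each finite divisor \<open>n\<close> of \<open>s\<close> separately, so it can be checked
  in a member of \<open>Z\<close> that has the divisor \<open>n\<close>: the divisor of that member found in a covering sieve
  on \<open>n\<close> divides \<open>s\<close> too.
\<close>

lemma closed_under_divisor_unions_points_of_topology:
  assumes K: "grothendieck_topology big_cell K"
  shows "closed_under_divisor_unions (points_of_topology K)"
  unfolding closed_under_divisor_unions_def
proof (intro allI impI)
  fix Z s assume Z: "Z \<subseteq> points_of_topology K" and s: "\<forall>n>0. n ndvd s \<longleftrightarrow> (\<exists>t\<in>Z. n ndvd t)"
  have "s \<in> supernat_open L" if n: "0 < n" "n ndvd s" and L: "L \<in> K n" for n L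
  proof -
    obtain t where t: "t \<in> Z" "n ndvd t" using n s by blast
    then obtain m where m: "m \<in> L" "m ndvd t"
      using Z n(1) L unfolding points_of_topology_def mem_supernat_open by blast
    moreover have "0 < m"
      using sieve_on_covering_sieve[OF K L] m(1) by (auto simp: sieve_on_def big_cell_def)
    ultimately show ?thesis using s t(1) unfolding mem_supernat_open by blast
  qed
  then show "s \<in> points_of_topology K" by (simp add: points_of_topology_def)
qed

text \<open>
  The proof is the prime ideal argument for the coherent frame of \<open>K\<close>-closed sieves; the finiteness
  condition is what makes a common member of the ideal for all generators available.
\<close>

lemma point_missing_noncovering_sieve:
  assumes K: "grothendieck_topology big_cell K"
    and fin: "\<forall>n\<in>Field big_cell. \<forall>L\<in>K n. \<exists>L'\<in>K n. L' \<subseteq> L \<and> finitely_generated_sieve_on big_cell n L'"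
    and L: "sieve_on big_cell n L" "L \<notin> K n"
  obtains s where "s \<in> points_of_topology K" "n ndvd s" "s \<notin> supernat_open L"
proof -
  have K_sieve: "\<And>c R. R \<in> K c \<Longrightarrow> sieve_on big_cell c R"
    and K_max: "\<And>c. c \<in> Field big_cell \<Longrightarrow> maximal_sieve big_cell c \<in> K c"
    and K_stable: "\<And>c d R. R \<in> K c \<Longrightarrow> (d, c) \<in> big_cell \<Longrightarrow> pullback_sieve big_cell d R \<in> K d"
    and K_trans: "\<And>c R T. R \<in> K c \<Longrightarrow> sieve_on big_cell c T \<Longrightarrow>
       (\<And>d. d \<in> R \<Longrightarrow> pullback_sieve big_cell d T \<in> K d) \<Longrightarrow> T \<in> K c"
    using K unfolding grothendieck_topology_def by blast+
  have n: "0 < n" using L(1) by (simp add: sieve_on_def Field_big_cell)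
  (* C is the K-closure of L, so n being outside C expresses that L does not cover n. *)
  define C where "C = {m. (m, n) \<in> big_cell \<and> pullback_sieve big_cell m L \<in> K m}"
  have C_up: "k \<in> C" if "m \<in> C" "(k, m) \<in> big_cell" for k m
  proof -
    have "pullback_sieve big_cell k (pullback_sieve big_cell m L) = pullback_sieve big_cell k L"
      using that(2) big_cell_trans by (auto simp: pullback_sieve_def)
    then show ?thesis
      using that K_stable[of "pullback_sieve big_cell m L" m k] big_cell_trans by (auto simp: C_def)
  qed
  have pull_sieve: "sieve_on big_cell a (pullback_sieve big_cell a L)" if "0 < a" for a
    using that L(1) big_cell_trans by (auto simp: sieve_on_def pullback_sieve_def Field_big_cell)
  have LC: "L \<subseteq> C"
  proof
    fix m assume m: "m \<in> L"
    then have "pullback_sieve big_cell m L = maximal_sieve big_cell m"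
      using L(1) by (auto simp: pullback_sieve_def maximal_sieve_def sieve_on_def)
    moreover have mn: "(m, n) \<in> big_cell" using m L(1) by (simp add: sieve_on_def)
    ultimately show "m \<in> C" using K_max[of m] by (auto simp: C_def Field_def)
  qed
  have "pullback_sieve big_cell n L = L"
    using L(1) by (auto simp: pullback_sieve_def sieve_on_def)
  then have nC: "n \<notin> C" using L(2) by (simp add: C_def)
  define \<A> where "\<A> = {I. divisor_ideal I \<and> n \<in> I \<and> I \<inter> C = {}}"
  have "{d. d dvd n} \<inter> C = {}" using nC by (auto simp: C_def big_cell_def dest: dvd_antisym)
  then have "{d. d dvd n} \<in> \<A>" using n divisor_ideal_divisors by (simp add: \<A>_def)
  then have ne: "\<A> \<noteq> {}" by blast
  have chain: "\<Union>\<C> \<in> \<A>" if "\<C> \<noteq> {}" "subset.chain \<A> \<C>" for \<C>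
  proof -
    have "\<C> \<subseteq> \<A>" using that(2) by (simp add: subset_chain_def)
    then show ?thesis
      using that divisor_ideal_Union_chain[OF that] by (auto simp: \<A>_def)
  qed
  obtain I where I: "I \<in> \<A>" "\<And>J. J \<in> \<A> \<Longrightarrow> I \<subseteq> J \<Longrightarrow> J = I"
    using subset_Zorn_nonempty[OF ne chain] by blast
  have idl: "divisor_ideal I" and nI: "n \<in> I" and IC: "I \<inter> C = {}" using I(1) by (auto simp: \<A>_def)
  have meets: "\<exists>a\<in>I. lcm a m \<in> C" if m: "0 < m" "m \<notin> I" for m
  proof -
    let ?J = "extend_ideal I m"
    have "I \<subseteq> ?J" by (auto simp: extend_ideal_def)
    moreover have "m \<in> ?J" using divisor_idealD(2)[OF idl] by (auto simp: extend_ideal_def)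
    ultimately have "?J \<notin> \<A>" using I(2)[of ?J] m(2) by blast
    then have "?J \<inter> C \<noteq> {}"
      using divisor_ideal_extend_ideal[OF idl m(1)] nI \<open>I \<subseteq> ?J\<close> by (auto simp: \<A>_def)
    then obtain c a where "c \<in> C" "a \<in> I" "c dvd lcm a m" by (auto simp: extend_ideal_def)
    moreover then have "(lcm a m, c) \<in> big_cell"
      using m(1) divisor_idealD(1)[OF idl] by (auto simp: big_cell_def C_def lcm_pos_nat)
    ultimately show ?thesis using C_up by blast
  qed
  have meets_covers: "R \<inter> I \<noteq> {}" if d: "d \<in> I" and R: "R \<in> K d" for d R
  proof
    assume disj: "R \<inter> I = {}"
    have d0: "0 < d" using d divisor_idealD(1)[OF idl] by blast
    obtain R' where R': "R' \<in> K d" "R' \<subseteq> R" "finitely_generated_sieve_on big_cell d R'"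
      using fin d0 R unfolding Field_big_cell by (meson greaterThan_iff)
    then obtain F where F: "finite F" "\<forall>m\<in>F. (m, d) \<in> big_cell" "R' = generated_sieve big_cell F"
      by (auto simp: finitely_generated_sieve_on_def)
    have "F \<subseteq> R'" using F by (fastforce simp: generated_sieve_def big_cell_def)
    have "\<forall>m\<in>F. \<exists>a\<in>I. lcm a m \<in> C"
    proof
      fix m assume m: "m \<in> F"
      then have "0 < m" using F(2) by (auto simp: big_cell_def)
      moreover have "m \<notin> I" using m \<open>F \<subseteq> R'\<close> R'(2) disj by blast
      ultimately show "\<exists>a\<in>I. lcm a m \<in> C" by (rule meets)
    qed
    then obtain f where f: "\<And>m. m \<in> F \<Longrightarrow> f m \<in> I \<and> lcm (f m) m \<in> C" by metis
    (* Including d makes R' restrict to a; including n makes a an object over n, as C requires. *)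
    define a where "a = Lcm (insert d (insert n (f ` F)))"
    have aI: "a \<in> I"
      unfolding a_def using f F(1) d nI by (intro divisor_ideal_Lcm[OF idl]) auto
    then have a0: "0 < a" using divisor_idealD(1)[OF idl] by blast
    have dvds: "d dvd a" "n dvd a" "\<And>m. m \<in> F \<Longrightarrow> f m dvd a"
      unfolding a_def by (auto intro!: dvd_Lcm)
    have ad: "(a, d) \<in> big_cell" and an: "(a, n) \<in> big_cell"
      using a0 d0 n dvds by (auto simp: big_cell_def)
    have "pullback_sieve big_cell a L \<in> K a"
    proof (rule K_trans[OF K_stable[OF R'(1) ad] pull_sieve[OF a0]])
      fix k assume "k \<in> pullback_sieve big_cell a R'"
      then obtain m where m: "m \<in> F" "(k, m) \<in> big_cell" and ka: "(k, a) \<in> big_cell"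
        by (auto simp: pullback_sieve_def F(3) generated_sieve_def)
      have "lcm (f m) m dvd k"
        using m dvds(3)[OF m(1)] ka by (auto simp: big_cell_def intro: dvd_trans)
      then have "(k, lcm (f m) m) \<in> big_cell"
        using m ka f[OF m(1)] by (auto simp: big_cell_def C_def)
      then have "k \<in> C" using C_up f m(1) by blast
      moreover have "pullback_sieve big_cell k (pullback_sieve big_cell a L) = pullback_sieve big_cell k L"
        using ka big_cell_trans by (auto simp: pullback_sieve_def)
      ultimately show "pullback_sieve big_cell k (pullback_sieve big_cell a L) \<in> K k"
        by (simp add: C_def)
    qed
    then have "a \<in> C" using an by (simp add: C_def)
    then show False using aI IC by blast
  qed
  obtain s where s: "\<forall>m>0. m ndvd s \<longleftrightarrow> m \<in> I"
    using supernat_of_divisor_ideal[OF idl] by blast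
  have "s \<in> points_of_topology K"
    unfolding points_of_topology_def mem_supernat_open
  proof (intro CollectI allI impI ballI)
    fix d R assume "0 < d" "d ndvd s" "R \<in> K d"
    then obtain m where "m \<in> R" "m \<in> I" using meets_covers s by blast
    moreover then have "m ndvd s" using s divisor_idealD(1)[OF idl] by blast
    ultimately show "\<exists>m\<in>R. m ndvd s" by blast
  qed
  moreover have "n ndvd s" using s n nI by blast
  moreover have "s \<notin> supernat_open L"
  proof
    assume "s \<in> supernat_open L"
    then obtain m where "m \<in> L" "m ndvd s" by (auto simp: mem_supernat_open)
    moreover then have "0 < m" using L(1) by (auto simp: sieve_on_def big_cell_def)
    ultimately show False using s LC IC by blast
  qed
  ultimately show ?thesis using that by blast
qed

lemma topology_of_points_of_topology:
  assumes K: "grothendieck_topology big_cell K"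
    and fin: "\<forall>n\<in>Field big_cell. \<forall>L\<in>K n. \<exists>L'\<in>K n. L' \<subseteq> L \<and> finitely_generated_sieve_on big_cell n L'"
  shows "K = topology_of_points (points_of_topology K)"
proof (intro ext set_eqI iffI)
  fix n L assume L: "L \<in> K n"
  then have "sieve_on big_cell n L" using sieve_on_covering_sieve[OF K] by blast
  moreover then have "0 < n" by (simp add: sieve_on_def Field_big_cell)
  ultimately show "L \<in> topology_of_points (points_of_topology K) n"
    using L by (auto simp: topology_of_points_def points_of_topology_def mem_supernat_open)
next
  fix n L assume L: "L \<in> topology_of_points (points_of_topology K) n"
  show "L \<in> K n"
  proof (rule ccontr)
    assume "L \<notin> K n"
    moreover have "sieve_on big_cell n L" using L by (simp add: topology_of_points_def)
    ultimately obtain s where "s \<in> points_of_topology K" "n ndvd s" "s \<notin> supernat_open L"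
      using point_missing_noncovering_sieve[OF K fin] by blast
    then show False using L by (auto simp: topology_of_points_def mem_supernat_open subset_iff)
  qed
qed

theorem proposition2p6:
  fixes K :: "nat \<Rightarrow> nat set set"
  assumes "grothendieck_topology big_cell K"
  shows "(\<forall>n\<in>Field big_cell. \<forall>L\<in>K n. \<exists>L'\<in>K n. L' \<subseteq> L \<and> finitely_generated_sieve_on big_cell n L')
     \<longleftrightarrow> (\<exists>S. patch localic_topology S \<and> K = topology_of_points S)"
proof
  assume fin: "\<forall>n\<in>Field big_cell. \<forall>L\<in>K n. \<exists>L'\<in>K n. L' \<subseteq> L \<and> finitely_generated_sieve_on big_cell n L'"
  let ?S = "points_of_topology K"
  have KS: "K = topology_of_points ?S" using topology_of_points_of_topology[OF assms fin] .
  have "\<forall>n>0. compactin localic_topology (supernat_open {n} \<inter> ?S)"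
    using finite_type_iff_compactin_basic[of ?S] fin unfolding KS[symmetric] by (rule iffD1)
  then have "patch localic_topology ?S"
    using closed_under_divisor_unions_points_of_topology[OF assms] by (intro patch_if_compact_and_closed_under_divisor_unions) auto
  with KS show "\<exists>S. patch localic_topology S \<and> K = topology_of_points S" by blast
next
  assume "\<exists>S. patch localic_topology S \<and> K = topology_of_points S"
  then obtain S where S: "patch localic_topology S" and KS: "K = topology_of_points S" by blast
  have "\<forall>n>0. compactin localic_topology (supernat_open {n} \<inter> S)"
    using S quasi_compact_openin_basic
    by (auto simp: patch_def quasi_compact_openin_def compactin_subtopology)
  then show "\<forall>n\<in>Field big_cell. \<forall>L\<in>K n. \<exists>L'\<in>K n. L' \<subseteq> L \<and> finitely_generated_sieve_on big_cell n L'"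
    unfolding KS finite_type_iff_compactin_basic .
qed

end
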